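(* Let $q$ be a prime power. Then for $\mu_q^{\infty}$-almost every sequence $\mathcal{S}\in\mathbb{F}_q^{\infty}$ (that is, for all $\mathcal{S}$ in a set of $\mu_q^\infty$-measure $1$), $$\liminf_{N\to\infty}\frac{E_N(\mathcal{S})}{N^{1/2}}\ge 1.$$
   Context: $\mathbb{F}_q$ is the finite field with $q$ elements, $\mathbb{F}_q^{\infty}$ is the space of all sequences $\mathcal{S}=(s_i)_{i=0}^\infty$ over $\mathbb{F}_q$, $\mu_q$ is the uniform probability measure on $\mathbb{F}_q$ (measure $1/q$ for each element), and $\mu_q^{\infty}$ is the complete product probability measure on $\mathbb{F}_q^{\infty}$ induced by $\mu_q$. For a sequence $\mathcal{S}=(s_i)_{i=0}^\infty$ over $\mathbb{F}_q$ with generating function $G(x)=\sum_{i=0}^\infty s_ix^i\in\mathbb{F}_q[[x]]$ and a positive integer $N$, the $N$th expansion complexity $E_N(\mathcal{S})$ is defined by $E_N(\mathcal{S})=0$ if $s_0=\cdots=s_{N-1}=0$, and otherwise $E_N(\mathcal{S})$ is the least total degree of a nonzero polynomial $h(x,y)\in\mathbb{F}_q[x,y]$ with $h(x,G(x))\equiv 0\bmod x^N$. *)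

theory Defs
  imports
    "HOL-Probability.Probability"
    "HOL-Computational_Algebra.Computational_Algebra"
begin

text \<open>
  A polynomial \<open>h(x,y)\<close> is represented as an element of \<open>K[x][y]\<close>: the outer variable is \<open>y\<close>,
  and \<open>coeff (coeff h j) i\<close> is the coefficient of \<open>x\<^sup>i y\<^sup>j\<close>.
\<close>

definition total_degree :: "'a::zero poly poly \<Rightarrow> nat" where
  "total_degree h =
     (if h = 0 then 0 else Max {i + j |i j. coeff (coeff h j) i \<noteq> 0})"

definition eval_at_fps :: "'a::comm_ring_1 poly poly \<Rightarrow> 'a fps \<Rightarrow> 'a fps" where
  "eval_at_fps h G = poly (map_poly fps_of_poly h) G"

definition expansion_complexity :: "(nat \<Rightarrow> 'a::field) \<Rightarrow> nat \<Rightarrow> nat" where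
  "expansion_complexity s N =
     (if \<forall>i<N. s i = 0 then 0
      else LEAST d. \<exists>h. h \<noteq> 0 \<and> fps_X ^ N dvd eval_at_fps h (Abs_fps s) \<and> total_degree h = d)"

definition sequence_measure :: "(nat \<Rightarrow> 'a::finite) measure" where
  "sequence_measure = completion (\<Pi>\<^sub>M i\<in>UNIV. uniform_count_measure UNIV)"

lemma total_degree_set_finite: "finite {i + j |i j. coeff (coeff h j) i \<noteq> 0}"
proof -
  have "{i + j |i j. coeff (coeff h j) i \<noteq> 0}
      \<subseteq> (\<Union>j\<le>degree h. \<Union>i\<le>degree (coeff h j). {i + j})"
  proof
    fix d assume "d \<in> {i + j |i j. coeff (coeff h j) i \<noteq> 0}"
    then obtain i j where d: "d = i + j" and ij: "coeff (coeff h j) i \<noteq> 0" by blast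
    from ij have "i \<le> degree (coeff h j)" by (rule le_degree)
    moreover from ij have "j \<le> degree h" by (metis coeff_0 le_degree)
    ultimately show "d \<in> (\<Union>j\<le>degree h. \<Union>i\<le>degree (coeff h j). {i + j})"
      using d by auto
  qed
  then show ?thesis by (rule finite_subset) simp
qed

lemma total_degree_set_nonempty:
  assumes "h \<noteq> 0"
  shows "{i + j |i j. coeff (coeff h j) i \<noteq> 0} \<noteq> {}"
proof -
  have "coeff (coeff h (degree h)) (degree (coeff h (degree h))) \<noteq> 0"
    using assms by simp
  then show ?thesis by blast
qed

lemma eval_at_fps_altdef:
  "eval_at_fps h G = (\<Sum>j\<le>degree h. fps_of_poly (coeff h j) * G ^ j)"
proof -
  have "degree (map_poly fps_of_poly h) = degree h"
    by (rule degree_map_poly) simp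
  then show ?thesis
    by (simp add: eval_at_fps_def poly_altdef coeff_map_poly)
qed

lemma expansion_complexity_witness:
  "\<exists>h. h \<noteq> 0 \<and> fps_X ^ N dvd eval_at_fps h (G :: 'a::field fps)"
proof (intro exI conjI)
  show "[:monom 1 N:] \<noteq> (0 :: 'a poly poly)" by simp
  show "fps_X ^ N dvd eval_at_fps [:monom 1 N:] G"
    by (simp add: eval_at_fps_altdef fps_of_poly_monom')
qed

lemma prob_space_sequence_measure:
  "prob_space (sequence_measure :: (nat \<Rightarrow> 'a::finite) measure)"
  unfolding sequence_measure_def
  by (intro prob_space.prob_space_completion prob_space_PiM prob_space_uniform_count_measure) auto

end

theory Submission
  imports
    Defs
    "Berlekamp_Zassenhaus.Unique_Factorization_Poly"
    "HOL-Real_Asymp.Real_Asymp"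
begin

text \<open>
  Fix \<open>0 < c < 1\<close>. A sequence with generating function \<open>G\<close> and \<open>E\<^sub>N \<le> c \<surd>N\<close> admits a nonzero \<open>h\<close> of total
  degree at most \<open>d = c \<surd>N\<close> with \<open>x\<^sup>N\<close> dividing \<open>h(x,G)\<close>. Such sequences form a set of measure at most
  \<open>d\<^sup>2 q\<^bsup>1-m\<^esup>\<close>, where \<open>m\<close> grows like \<open>(1/c - c) \<surd>N\<close>. This is summable in \<open>N\<close>, so Borel--Cantelli and
  \<open>c \<rightarrow> 1\<close> give the result.

  For the estimate put \<open>L = \<lfloor>\<surd>N / c\<rfloor>\<close> and compare orders of vanishing with degrees: \<open>x\<close> divides
  \<open>h(x,G)\<close> at least \<open>L\<close> times per unit of total degree. Order and degree are both additive on products, so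
  this inequality passes to some factor, and among all nonconstant polynomials satisfying it one of least
  degree \<open>D \<le> d\<close> is irreducible. It is also separable in \<open>y\<close>: if \<open>h\<^sub>y = 0\<close>, then \<open>h\<^sub>x(x,G)\<close> is the
  derivative of \<open>h(x,G)\<close>, so \<open>h\<^sub>x\<close> would satisfy the inequality in smaller degree; and both derivatives cannot vanish, since
  over a finite field \<open>h\<close> would be a \<open>p\<close>-th power
  (\<open>vanishes_at_slope_imp_irreducible_separable\<close>).

  For this irreducible \<open>h\<close>, Bezout's inequality bounds the dimension of \<open>K[x,y]/(h,h\<^sub>y)\<close> by \<open>D(D-1)\<close>. On the
  other hand, \<open>h(x,G)\<close> is divisible by a high power of \<open>x\<close>, and if \<open>e\<close> denotes the order of
  \<open>h\<^sub>y(x,G)\<close>, then values and first \<open>y\<close>-derivatives at \<open>G\<close> exhibit \<open>2e\<close> independent elements of that quotient.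
  Hence \<open>e \<le> D(D-1)/2\<close> (\<open>subdegree_eval_pderiv_le\<close>). The factor \<open>1/2\<close> is what makes the constant \<open>1\<close> in the
  theorem reachable: the same bound comes from the discriminant, in which every pair of roots is counted twice.

  By Hensel's lemma, \<open>G\<close> agrees with one of the at most \<open>D\<close> power series roots of \<open>h\<close> to order
  \<open>LD - D(D-1)/2\<close>. There are at most \<open>q\<^bsup>(D+1)(D+2)/2\<^esup>\<close> polynomials of degree \<open>D\<close>, and the exponents add
  up to \<open>D(D + 1 - L) + 1\<close>, which is at most \<open>1 - (L - d - 1)\<close> (\<open>near_roots_of_degree_upto_measure\<close>).
\<close>

section \<open>Total degree of bivariate polynomials\<close>

text \<open>
  The homomorphism \<open>h(x,y) \<mapsto> h(z, yz)\<close> from \<open>K[x][y]\<close> to \<open>K[y][z]\<close>. It maps \<open>x\<^sup>i y\<^sup>j\<close> to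
  \<open>y\<^sup>j z\<^bsup>i+j\<^esup>\<close>, so it is injective and turns the total degree into an ordinary degree in \<open>z\<close>;
  multiplicativity of the total degree then follows from that of \<open>degree\<close>.
\<close>

definition total_degree_grading :: "'a::comm_ring_1 poly poly \<Rightarrow> 'a poly poly" where
  "total_degree_grading h = poly (map_poly (map_poly (\<lambda>c. [:c:])) h) [:0, [:0, 1:]:]"

lemma total_degree_grading_pCons:
  "total_degree_grading (pCons a p) =
     map_poly (\<lambda>c. [:c:]) a + [:0, [:0, 1:]:] * total_degree_grading p"
  by (cases "a = 0 \<and> p = 0") (auto simp: total_degree_grading_def map_poly_pCons)

lemma total_degree_grading_0 [simp]: "total_degree_grading 0 = 0"
  by (simp add: total_degree_grading_def)

lemma coeff_total_degree_grading:
  "coeff (coeff (total_degree_grading h) n) j = (if j \<le> n then coeff (coeff h j) (n - j) else 0)"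
proof (induction h arbitrary: n j)
  case (pCons a p)
  show ?case
    by (cases n; cases j) (auto simp: total_degree_grading_pCons coeff_map_poly pCons.IH)
qed simp

lemma total_degree_grading_add:
  "total_degree_grading (f + g) = total_degree_grading f + total_degree_grading g"
  by (rule poly_eqI, rule poly_eqI) (simp add: coeff_total_degree_grading)

lemma total_degree_grading_eq_0_iff: "total_degree_grading h = 0 \<longleftrightarrow> h = 0"
proof
  assume z: "total_degree_grading h = 0"
  have "coeff (coeff h j) i = 0" for i j
    using coeff_total_degree_grading[of h "i + j" j] z by simp
  then show "h = 0" by (auto intro!: poly_eqI)
qed simp

lemma map_poly_lift_mult:
  fixes a b :: "'a::comm_ring_1 poly"
  shows "map_poly (\<lambda>c. [:c:]) (a * b) = map_poly (\<lambda>c. [:c:]) a * map_poly (\<lambda>c. [:c:]) b"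
proof -
  have sum: "(\<Sum>x\<in>A. [:f x:]) = [:\<Sum>x\<in>A. f x:]" for f :: "nat \<Rightarrow> 'a" and A
    by (induction A rule: infinite_finite_induct) auto
  show ?thesis
    by (rule poly_eqI) (simp add: coeff_map_poly coeff_mult sum mult.commute)
qed

lemma total_degree_grading_smult:
  "total_degree_grading (smult a q) = map_poly (\<lambda>c. [:c:]) a * total_degree_grading q"
proof (induction q)
  case (pCons b q)
  show ?case
    by (simp only: smult_pCons total_degree_grading_pCons map_poly_lift_mult pCons.IH
        distrib_left mult_ac)
qed simp

lemma total_degree_grading_mult:
  "total_degree_grading (f * g) = total_degree_grading f * total_degree_grading g"
proof (induction f)
  case (pCons a p)
  define Y :: "'a poly poly" where "Y = [:0, [:0, 1:]:]"
  have pCons': "total_degree_grading (pCons b q) =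
      map_poly (\<lambda>c. [:c:]) b + Y * total_degree_grading q" for b and q :: "'a poly poly"
    by (simp only: Y_def total_degree_grading_pCons)
  have "total_degree_grading (pCons 0 (p * g)) = Y * total_degree_grading (p * g)"
    by (simp only: pCons' map_poly_0 add_0_left)
  then show ?case
    by (simp only: mult_pCons_left total_degree_grading_add total_degree_grading_smult
        pCons' pCons.IH distrib_right mult.assoc)
qed simp

lemma total_degree_0 [simp]: "total_degree 0 = 0"
  by (simp add: total_degree_def)

lemma total_degree_le_iff:
  "total_degree h \<le> n \<longleftrightarrow> (\<forall>i j. coeff (coeff h j) i \<noteq> 0 \<longrightarrow> i + j \<le> n)"
proof (cases "h = 0")
  case False
  have "total_degree h \<le> n \<longleftrightarrow> (\<forall>k\<in>{i + j |i j. coeff (coeff h j) i \<noteq> 0}. k \<le> n)"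
    unfolding total_degree_def using False
    by (simp only: if_False Max_le_iff[OF total_degree_set_finite total_degree_set_nonempty[OF False]])
  also have "\<dots> \<longleftrightarrow> (\<forall>i j. coeff (coeff h j) i \<noteq> 0 \<longrightarrow> i + j \<le> n)"
    by blast
  finally show ?thesis .
qed (simp add: total_degree_def)

lemma total_degree_eq_degree_grading: "total_degree h = degree (total_degree_grading h)"
proof (rule antisym)
  show "total_degree h \<le> degree (total_degree_grading h)"
    unfolding total_degree_le_iff
  proof safe
    fix i j assume "coeff (coeff h j) i \<noteq> 0"
    then have "coeff (coeff (total_degree_grading h) (i + j)) j \<noteq> 0"
      by (simp add: coeff_total_degree_grading)
    then have "coeff (total_degree_grading h) (i + j) \<noteq> 0" by auto
    then show "i + j \<le> degree (total_degree_grading h)" by (rule le_degree)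
  qed
  show "degree (total_degree_grading h) \<le> total_degree h"
  proof (rule degree_le, safe)
    fix n assume n: "total_degree h < n"
    show "coeff (total_degree_grading h) n = 0"
    proof (rule poly_eqI)
      fix j
      have "coeff (coeff h j) (n - j) = 0" if "j \<le> n"
        using total_degree_le_iff[of h "total_degree h"] n that by fastforce
      then show "coeff (coeff (total_degree_grading h) n) j = coeff 0 j"
        by (simp add: coeff_total_degree_grading)
    qed
  qed
qed

lemma total_degree_mult:
  fixes f g :: "'a::idom poly poly"
  assumes "f \<noteq> 0" "g \<noteq> 0"
  shows "total_degree (f * g) = total_degree f + total_degree g"
  using assms
  by (simp add: total_degree_eq_degree_grading total_degree_grading_mult degree_mult_eq
      total_degree_grading_eq_0_iff)

lemma total_degree_mult_le:
  fixes f g :: "'a::idom poly poly"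
  shows "total_degree (f * g) \<le> total_degree f + total_degree g"
  by (simp add: total_degree_eq_degree_grading total_degree_grading_mult degree_mult_le)

lemma total_degree_add_le:
  fixes f g :: "'a::comm_ring_1 poly poly"
  assumes "total_degree f \<le> n" "total_degree g \<le> n"
  shows "total_degree (f + g) \<le> n"
  using assms
  by (simp add: total_degree_eq_degree_grading total_degree_grading_add degree_add_le)

lemma total_degree_diff_le:
  fixes f g :: "'a::comm_ring_1 poly poly"
  assumes "total_degree f \<le> n" "total_degree g \<le> n"
  shows "total_degree (f - g) \<le> n"
  unfolding total_degree_le_iff
proof safe
  fix i j assume "coeff (coeff (f - g) j) i \<noteq> 0"
  then have "coeff (coeff f j) i \<noteq> 0 \<or> coeff (coeff g j) i \<noteq> 0" by auto
  then show "i + j \<le> n" using assms by (auto simp: total_degree_le_iff)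
qed

lemma total_degree_eq_0_imp_const:
  assumes "total_degree h = 0"
  shows "h = [:[:coeff (coeff h 0) 0:]:]"
proof (rule poly_eqI, rule poly_eqI)
  fix i j
  have "coeff (coeff h j) i = 0" if "i + j > 0"
    using total_degree_le_iff[of h 0] that assms by fastforce
  then show "coeff (coeff h j) i = coeff (coeff [:[:coeff (coeff h 0) 0:]:] j) i"
    by (cases i; cases j) auto
qed

lemma is_unit_iff_total_degree_eq_0:
  fixes h :: "'a::field poly poly"
  assumes "h \<noteq> 0"
  shows "is_unit h \<longleftrightarrow> total_degree h = 0"
proof
  assume "is_unit h"
  then obtain g where g: "1 = h * g" by blast
  have "total_degree (1 :: 'a poly poly) = 0"
    using total_degree_le_iff[of "1 :: 'a poly poly" 0] by (auto split: if_splits)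
  moreover have "total_degree (h * g) = total_degree h + total_degree g"
    using assms g by (intro total_degree_mult) auto
  ultimately show "total_degree h = 0" using g by simp
next
  assume "total_degree h = 0"
  then obtain c where c: "h = [:[:c:]:]" using total_degree_eq_0_imp_const by blast
  with assms have "c \<noteq> 0" by auto
  then have "1 = h * [:[:inverse c:]:]" by (simp add: c)
  then show "is_unit h" by (rule dvdI)
qed

lemma total_degree_pderiv_le: "total_degree (pderiv h) \<le> total_degree h - 1"
  unfolding total_degree_le_iff
proof safe
  fix i j assume "coeff (coeff (pderiv h) j) i \<noteq> 0"
  then have "coeff ([:of_nat (Suc j):] * coeff h (Suc j)) i \<noteq> 0"
    unfolding coeff_pderiv of_nat_poly .
  moreover have "coeff ([:c:] * p) i = c * coeff p i" for c :: 'a and p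
    by simp
  ultimately have "coeff (coeff h (Suc j)) i \<noteq> 0"
    by (metis mult_zero_right)
  then show "i + j \<le> total_degree h - 1"
    using total_degree_le_iff[of h "total_degree h"] by fastforce
qed

lemma coeff_map_poly_pderiv: "coeff (map_poly pderiv h) j = pderiv (coeff h j)"
  by (simp add: coeff_map_poly)

lemma total_degree_map_poly_pderiv_le: "total_degree (map_poly pderiv h) \<le> total_degree h - 1"
  unfolding total_degree_le_iff
proof safe
  fix i j assume "coeff (coeff (map_poly pderiv h) j) i \<noteq> 0"
  then have "coeff (coeff h j) (Suc i) \<noteq> 0"
    by (auto simp: coeff_map_poly_pderiv coeff_pderiv)
  then show "i + j \<le> total_degree h - 1"
    using total_degree_le_iff[of h "total_degree h"] by fastforce
qed

section \<open>Evaluation at a power series\<close>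

lemma eval_at_fps_0 [simp]: "eval_at_fps 0 G = 0"
  by (simp add: eval_at_fps_def)

lemma eval_at_fps_pCons:
  "eval_at_fps (pCons a p) G = fps_of_poly a + G * eval_at_fps p G"
  by (cases "a = 0 \<and> p = 0") (auto simp: eval_at_fps_def map_poly_pCons)

lemma eval_at_fps_add: "eval_at_fps (f + g) G = eval_at_fps f G + eval_at_fps g G"
  by (induction f g rule: poly_induct2)
     (auto simp: eval_at_fps_pCons fps_of_poly_add algebra_simps)

lemma eval_at_fps_smult: "eval_at_fps (smult a f) G = fps_of_poly a * eval_at_fps f G"
  by (induction f) (auto simp: eval_at_fps_pCons fps_of_poly_mult algebra_simps)

lemma eval_at_fps_mult: "eval_at_fps (f * g) G = eval_at_fps f G * eval_at_fps g G"
proof (induction f)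
  case (pCons a p)
  have "eval_at_fps (pCons 0 (p * g)) G = G * eval_at_fps (p * g) G"
    by (simp only: eval_at_fps_pCons fps_of_poly_0 add_0_left)
  then show ?case
    by (simp only: mult_pCons_left eval_at_fps_add eval_at_fps_smult
        eval_at_fps_pCons pCons.IH distrib_right mult.assoc)
qed simp

lemma pderiv_map_fps_of_poly:
  "pderiv (map_poly fps_of_poly h) = map_poly fps_of_poly (pderiv (h :: 'a::idom poly poly))"
proof (rule poly_eqI)
  fix n
  have eq: "fps_of_poly (of_nat m) = (of_nat m :: 'a fps)" for m
    by (induction m) (auto simp: fps_of_poly_add)
  show "coeff (pderiv (map_poly fps_of_poly h)) n = coeff (map_poly fps_of_poly (pderiv h)) n"
    by (simp only: coeff_pderiv coeff_map_poly[where f = fps_of_poly, OF fps_of_poly_0] fps_of_poly_mult eq)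
qed

text \<open>
  The chain rule, with \<open>map_poly pderiv\<close> the derivative in \<open>x\<close> and \<open>pderiv\<close> the derivative in \<open>y\<close>.
\<close>

lemma fps_deriv_eval_at_fps:
  fixes h :: "'a::idom poly poly"
  shows "fps_deriv (eval_at_fps h G) =
     eval_at_fps (map_poly pderiv h) G + eval_at_fps (pderiv h) G * fps_deriv G"
proof (induction h)
  case (pCons a p)
  have "map_poly pderiv (pCons a p) = pCons (pderiv a) (map_poly pderiv p)"
    using pCons.hyps by (simp add: map_poly_pCons)
  then show ?case
    by (simp only: eval_at_fps_pCons pderiv_pCons eval_at_fps_add fps_of_poly_pderiv fps_of_poly_0
        fps_deriv_add fps_deriv_mult pCons.IH add_0_left distrib_left distrib_right ac_simps)
qed simp

lemma fps_X_power_dvd_iff_nth: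
  "fps_X ^ n dvd (F :: 'a::comm_ring_1 fps) \<longleftrightarrow> (\<forall>i<n. F $ i = 0)"
proof
  assume "\<forall>i<n. F $ i = 0"
  then have "fps_cutoff n F = 0" by (simp add: fps_eq_iff)
  with fps_shift_cutoff'[of n F] have "F = fps_X ^ n * fps_shift n F" by simp
  then show "fps_X ^ n dvd F" by (rule dvdI)
qed (auto simp: fps_X_power_mult_nth elim!: dvdE)

lemma fps_X_power_dvd_iff_subdegree:
  "fps_X ^ n dvd (F :: 'a::comm_ring_1 fps) \<longleftrightarrow> F = 0 \<or> n \<le> subdegree F"
  by (metis fps_X_power_dvd_iff_nth nth_less_subdegree_zero subdegree_geI less_le_trans dvd_0_right)

text \<open>
  The pigeonhole step by which a factor inherits a ratio between order of vanishing and degree.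
\<close>

lemma fps_X_power_add_dvd_multD:
  fixes F G :: "'a::idom fps"
  assumes "fps_X ^ (a + b) dvd F * G"
  shows "fps_X ^ a dvd F \<or> fps_X ^ b dvd G"
  using assms by (cases "F = 0 \<or> G = 0") (auto simp: fps_X_power_dvd_iff_subdegree)

lemma fps_X_power_dvd_mult_cancel:
  fixes F G :: "'a::idom fps"
  assumes "fps_X ^ n dvd F * G" "F \<noteq> 0"
  shows "fps_X ^ (n - subdegree F) dvd G"
  using assms by (cases "G = 0") (auto simp: fps_X_power_dvd_iff_subdegree)

lemma fps_X_power_dvd_fps_deriv:
  assumes "fps_X ^ n dvd (F :: 'a::comm_ring_1 fps)"
  shows "fps_X ^ (n - 1) dvd fps_deriv F"
  using assms by (auto simp: fps_X_power_dvd_iff_nth)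

section \<open>Polynomials with vanishing derivatives in positive characteristic\<close>

text \<open>
  A vanishing derivative leaves only exponents divisible by the characteristic, so the root is read off
  from the coefficients by the freshman's dream. The hypothesis asks for roots of the coefficients in the ring,
  rather than for a perfect field, so that the lemma can be applied first to \<open>K[x]\<close> and then to \<open>K[x][y]\<close>.
\<close>

lemma pderiv_eq_0_imp_power_CHAR:
  fixes f :: "'a::idom poly"
  assumes p: "prime CHAR('a)" and root: "\<And>j. \<exists>c. coeff f j = c ^ CHAR('a)"
    and "pderiv f = 0"
  shows "\<exists>g. f = g ^ CHAR('a)"
proof -
  define p where "p = CHAR('a)"
  have "p > 0" using p prime_gt_0_nat unfolding p_def by blast
  obtain r where r: "coeff f j = r j ^ p" for j using root unfolding p_def by metis
  have gap: "coeff f j = 0" if "\<not> p dvd j" for j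
  proof -
    from that obtain i where j: "j = Suc i" by (cases j) auto
    have "of_nat j * coeff f j = coeff (pderiv f) i" by (simp add: j coeff_pderiv)
    moreover have "of_nat j \<noteq> (0 :: 'a)"
      using that by (simp add: of_nat_eq_0_iff_char_dvd p_def)
    ultimately show ?thesis using \<open>pderiv f = 0\<close> by simp
  qed
  define g where "g = (\<Sum>k\<le>degree f. monom (r (p * k)) k)"
  have "prime CHAR('a poly)" "CHAR('a poly) = p" using p by (simp_all add: p_def)
  then have "g ^ p = (\<Sum>k\<le>degree f. monom (r (p * k)) k ^ p)"
    unfolding g_def by (intro freshmans_dream_sum) auto
  also have "\<dots> = (\<Sum>k\<le>degree f. monom (coeff f (p * k)) (p * k))"
    by (simp add: monom_power r mult.commute)
  also have "\<dots> = f"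
  proof (rule poly_eqI)
    fix n
    have "coeff (\<Sum>k\<le>degree f. monom (coeff f (p * k)) (p * k)) n =
        (\<Sum>k\<le>degree f. if p * k = n then coeff f n else 0)"
      by (simp add: coeff_sum cong: if_cong sum.cong)
    also have "\<dots> = coeff f n"
    proof (cases "p dvd n \<and> n \<le> degree f")
      case True
      then obtain m where n: "n = p * m" by blast
      have "m \<le> p * m" using \<open>p > 0\<close> by simp
      then have "m \<le> degree f" using True n by linarith
      then show ?thesis using \<open>p > 0\<close> by (simp add: n sum.delta)
    next
      case False
      then have "coeff f n = 0" using gap coeff_eq_0[of f n] by force
      then show ?thesis by (auto intro!: sum.neutral)
    qed
    finally show "coeff (\<Sum>k\<le>degree f. monom (coeff f (p * k)) (p * k)) n = coeff f n" .
  qed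
  finally show ?thesis unfolding p_def by metis
qed

text \<open>
  The Frobenius map is additive, hence injective, hence surjective by finiteness.
\<close>

lemma finite_field_power_CHAR_surj:
  fixes c :: "'a::{field,finite}"
  shows "\<exists>b. c = b ^ CHAR('a)"
proof -
  have p: "prime CHAR('a)"
    by (intro prime_CHAR_semidom finite_imp_CHAR_pos) simp
  have "inj (\<lambda>x::'a. x ^ CHAR('a))"
  proof (rule injI)
    fix x y :: 'a assume eq: "x ^ CHAR('a) = y ^ CHAR('a)"
    have "((x - y) + y) ^ CHAR('a) = (x - y) ^ CHAR('a) + y ^ CHAR('a)"
      by (rule freshmans_dream[OF p refl])
    with eq show "x = y" by simp
  qed
  then have "surj (\<lambda>x::'a. x ^ CHAR('a))" by (rule finite_UNIV_inj_surj[OF finite])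
  then show ?thesis by (rule surjD)
qed

lemma both_pderivs_eq_0_imp_power_CHAR:
  fixes h :: "'a::{field,finite} poly poly"
  assumes "pderiv h = 0" "map_poly pderiv h = 0"
  shows "\<exists>g. h = g ^ CHAR('a)"
proof -
  have p: "prime CHAR('a)"
    by (intro prime_CHAR_semidom finite_imp_CHAR_pos) simp
  have "\<exists>c. coeff h j = c ^ CHAR('a poly)" for j
  proof -
    have "pderiv (coeff h j) = 0"
      using assms(2) by (metis coeff_map_poly_pderiv coeff_0)
    then have "\<exists>c. coeff h j = c ^ CHAR('a)"
      using p finite_field_power_CHAR_surj by (intro pderiv_eq_0_imp_power_CHAR)
    then show ?thesis by simp
  qed
  then have "\<exists>g. h = g ^ CHAR('a poly)"
    using p assms(1) by (intro pderiv_eq_0_imp_power_CHAR) simp_all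
  then show ?thesis by simp
qed

lemma irreducible_imp_pderiv_nonzero:
  fixes h :: "'a::{field,finite} poly poly"
  assumes irr: "irreducible h"
  shows "pderiv h \<noteq> 0 \<or> map_poly pderiv h \<noteq> 0"
proof (rule ccontr)
  assume "\<not> ?thesis"
  then obtain g where g: "h = g ^ CHAR('a)" using both_pderivs_eq_0_imp_power_CHAR by blast
  have "prime CHAR('a)"
    by (intro prime_CHAR_semidom finite_imp_CHAR_pos) simp
  then obtain k where k: "CHAR('a) = Suc (Suc k)"
    by (metis prime_ge_2_nat add_2_eq_Suc le_Suc_ex)
  have "h = g * g ^ Suc k" using g k by simp
  then have "is_unit g \<or> is_unit (g ^ Suc k)" using irr by (auto dest: irreducibleD)
  then have "is_unit g" using is_unit_power_iff[of g "Suc k"] by blast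
  then have "is_unit h" unfolding g by (simp add: is_unit_power_iff)
  then show False using irr irreducible_not_unit by blast
qed

section \<open>Reduction to irreducible separable polynomials\<close>

text \<open>
  The order of \<open>h(x,G)\<close> is at least \<open>L\<close> times the degree of \<open>h\<close>. Both sides are additive in \<open>h\<close>, so this
  condition, unlike \<open>x\<^sup>N | h(x,G)\<close>, is inherited by a factor of \<open>h\<close>.
\<close>

definition vanishes_at_slope :: "nat \<Rightarrow> 'a::field poly poly \<Rightarrow> 'a fps \<Rightarrow> bool" where
  "vanishes_at_slope L h G \<longleftrightarrow>
     0 < total_degree h \<and> fps_X ^ (L * total_degree h) dvd eval_at_fps h G"

text \<open>
  A polynomial of least degree with the property has both features, because a proper factor or the derivative
  in \<open>x\<close> would be a smaller one. The bound \<open>2 \<le> L\<close> excludes a constant derivative in \<open>x\<close>: it leaves a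
  positive order of vanishing after differentiation.
\<close>

lemma vanishes_at_slope_imp_irreducible_separable:
  fixes h :: "'a::{field,finite} poly poly"
  assumes "L \<ge> 2" and "vanishes_at_slope L h G"
  obtains f where "total_degree f \<le> total_degree h" "vanishes_at_slope L f G"
    "irreducible f" "pderiv f \<noteq> 0"
proof -
  obtain f where f: "vanishes_at_slope L f G"
    and minimal: "\<And>g. vanishes_at_slope L g G \<Longrightarrow> total_degree f \<le> total_degree g"
    using arg_min_nat_lemma[of "\<lambda>g. vanishes_at_slope L g G" h total_degree] assms(2) by blast
  have pos: "0 < total_degree f" and dvd: "fps_X ^ (L * total_degree f) dvd eval_at_fps f G"
    using f by (auto simp: vanishes_at_slope_def)
  then have nz: "f \<noteq> 0" by (auto simp: total_degree_def)
  have irr: "irreducible f"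
  proof (rule irreducibleI)
    show "f \<noteq> 0" "\<not> is_unit f" using nz pos by (auto simp: is_unit_iff_total_degree_eq_0)
  next
    fix a b assume ab: "f = a * b"
    then have anz: "a \<noteq> 0" and bnz: "b \<noteq> 0" using nz by auto
    have deg: "total_degree f = total_degree a + total_degree b"
      using ab anz bnz by (simp add: total_degree_mult)
    have split: "fps_X ^ (L * total_degree a) dvd eval_at_fps a G \<or>
        fps_X ^ (L * total_degree b) dvd eval_at_fps b G"
      using dvd by (intro fps_X_power_add_dvd_multD) (simp add: ab[symmetric] deg[symmetric] eval_at_fps_mult[symmetric] distrib_left[symmetric])
    show "is_unit a \<or> is_unit b"
    proof (rule ccontr)
      assume "\<not> ?thesis"
      then have "0 < total_degree a" "0 < total_degree b"
        using anz bnz by (auto simp: is_unit_iff_total_degree_eq_0)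
      with split minimal[of a] minimal[of b] deg show False
        by (auto simp: vanishes_at_slope_def)
    qed
  qed
  have "pderiv f \<noteq> 0"
  proof
    assume z: "pderiv f = 0"
    \<comment> \<open>Differentiation costs one order of vanishing and at least one degree, and a degree is worth \<open>L \<ge> 1\<close>
      orders, so the derivative in \<open>x\<close> satisfies the condition in smaller degree.\<close>
    define g where "g = map_poly pderiv f"
    have gnz: "g \<noteq> 0" using irreducible_imp_pderiv_nonzero[OF irr] z by (simp add: g_def)
    have deg: "total_degree g \<le> total_degree f - 1"
      unfolding g_def by (rule total_degree_map_poly_pderiv_le)
    have "eval_at_fps g G = fps_deriv (eval_at_fps f G)"
      using z by (simp add: fps_deriv_eval_at_fps g_def)
    then have g_dvd: "fps_X ^ (L * total_degree f - 1) dvd eval_at_fps g G"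
      using fps_X_power_dvd_fps_deriv[OF dvd] by metis
    show False
    proof (cases "total_degree g = 0")
      case True
      then obtain c where c: "g = [:[:c:]:]" using total_degree_eq_0_imp_const by blast
      with gnz have "c \<noteq> 0" by auto
      have "2 * 1 \<le> L * total_degree f" using assms(1) pos by (intro mult_le_mono) auto
      then have "0 < L * total_degree f - 1" by simp
      with g_dvd have "eval_at_fps g G $ 0 = 0" by (auto simp: fps_X_power_dvd_iff_nth)
      then show False using \<open>c \<noteq> 0\<close> by (simp add: c eval_at_fps_pCons)
    next
      case False
      have "L * total_degree g \<le> L * (total_degree f - 1)" using deg by simp
      also have "\<dots> \<le> L * total_degree f - 1" using assms(1) by (simp add: diff_mult_distrib2)
      finally have "vanishes_at_slope L g G"
        using False g_dvd by (auto simp: vanishes_at_slope_def intro: power_le_dvd)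
      from minimal[OF this] deg pos show False by simp
    qed
  qed
  with that[OF minimal[OF assms(2)] f irr] show thesis by blast
qed

section \<open>Bezout's inequality\<close>

lemma card_polys_coeff_eq_0:
  "card {p :: 'a::{comm_ring_1,finite} poly. \<forall>i\<ge>n. coeff p i = 0} = CARD('a) ^ n"
  "finite {p :: 'a::{comm_ring_1,finite} poly. \<forall>i\<ge>n. coeff p i = 0}"
proof -
  let ?P = "{p :: 'a poly. \<forall>i\<ge>n. coeff p i = 0}"
  have bij: "bij_betw (\<lambda>p. restrict (coeff p) {..<n}) ?P (PiE {..<n} (\<lambda>_. UNIV))"
  proof (rule bij_betwI[where g = "\<lambda>f. \<Sum>i<n. monom (f i) i"])
    show "(\<lambda>f. \<Sum>i<n. monom (f i) i) \<in> (PiE {..<n} (\<lambda>_. UNIV)) \<rightarrow> ?P"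
      by (auto simp: coeff_sum intro!: sum.neutral)
  next
    fix p :: "'a poly" assume "p \<in> ?P"
    then show "(\<Sum>i<n. monom (restrict (coeff p) {..<n} i) i) = p"
      by (intro poly_eqI) (auto simp: coeff_sum sum.delta)
  next
    fix f :: "nat \<Rightarrow> 'a" assume "f \<in> PiE {..<n} (\<lambda>_. UNIV)"
    then show "restrict (coeff (\<Sum>i<n. monom (f i) i)) {..<n} = f"
      by (intro ext) (auto simp: coeff_sum sum.delta PiE_def extensional_def restrict_def)
  qed auto
  show "card ?P = CARD('a) ^ n"
    using bij_betw_same_card[OF bij] by (simp add: card_PiE)
  show "finite ?P"
    using bij_betw_finite[OF bij] by (simp add: finite_PiE)
qed

lemma card_sum_le_pairs:
  "2 * card {(i, j). i + j \<le> (n::nat)} = (n + 1) * (n + 2)" "finite {(i, j). i + j \<le> (n::nat)}"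
proof -
  have eq: "{(i, j). i + j \<le> n} = Sigma {..n} (\<lambda>i. {..n - i})" by auto
  have "(\<Sum>i\<le>n. Suc (n - i)) = (\<Sum>i\<le>n. Suc i)" 
    by (rule sum.reindex_bij_witness[of _ "\<lambda>i. n - i" "\<lambda>i. n - i"]) auto
  moreover have "2 * (\<Sum>i\<le>n. Suc i) = (n + 1) * (n + 2)" by (induction n) auto
  ultimately show "2 * card {(i, j). i + j \<le> n} = (n + 1) * (n + 2)"
    by (simp add: eq card_SigmaI)
  show "finite {(i, j). i + j \<le> n}" by (simp add: eq)
qed

lemma card_polys_total_degree_le:
  "card {h :: 'a::{comm_ring_1,finite} poly poly. total_degree h \<le> n} = CARD('a) ^ ((n + 1) * (n + 2) div 2)"
  "finite {h :: 'a::{comm_ring_1,finite} poly poly. total_degree h \<le> n}"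
proof -
  let ?P = "{h :: 'a poly poly. total_degree h \<le> n}"
  let ?T = "{(i, j). i + j \<le> n}"
  have fin: "finite ?T" by (rule card_sum_le_pairs)
  have coeff_sum': "coeff (coeff (\<Sum>(i, j)\<in>?T. monom (monom (f (i, j)) i) j) j') i' =
      (if i' + j' \<le> n then f (i', j') else 0)" for f :: "nat \<times> nat \<Rightarrow> 'a" and i' j'
  proof -
    have "coeff (coeff (\<Sum>(i, j)\<in>?T. monom (monom (f (i, j)) i) j) j') i' =
        (\<Sum>x\<in>?T. if x = (i', j') then f x else 0)"
      by (auto simp: coeff_sum case_prod_unfold intro!: sum.cong)
    also have "\<dots> = (if i' + j' \<le> n then f (i', j') else 0)"
      using fin by (simp add: sum.delta)
    finally show ?thesis .
  qed
  have bij: "bij_betw (\<lambda>h. restrict (\<lambda>(i, j). coeff (coeff h j) i) ?T) ?P (PiE ?T (\<lambda>_. UNIV))"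
  proof (rule bij_betwI[where g = "\<lambda>f. \<Sum>(i, j)\<in>?T. monom (monom (f (i, j)) i) j"])
    show "(\<lambda>f. \<Sum>(i, j)\<in>?T. monom (monom (f (i, j)) i) j) \<in> (PiE ?T (\<lambda>_. UNIV)) \<rightarrow> ?P"
      by (auto simp: total_degree_le_iff coeff_sum' split: if_splits)
  next
    fix h :: "'a poly poly" assume "h \<in> ?P"
    then have "coeff (coeff h j) i = 0" if "\<not> i + j \<le> n" for i j
      using that by (auto simp: total_degree_le_iff)
    then show "(\<Sum>(i, j)\<in>?T. monom (monom (restrict (\<lambda>(i, j). coeff (coeff h j) i) ?T (i, j)) i) j) = h"
      by (intro poly_eqI) (simp only: coeff_sum', auto)
  next
    fix f :: "nat \<times> nat \<Rightarrow> 'a" assume f: "f \<in> PiE ?T (\<lambda>_. UNIV)"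
    show "restrict (\<lambda>(i', j'). coeff (coeff (\<Sum>(i, j)\<in>?T. monom (monom (f (i, j)) i) j) j') i') ?T = f"
      using f by (intro ext) (auto simp only: coeff_sum' PiE_def extensional_def restrict_def split: if_splits)
  qed auto
  have "card ?P = CARD('a) ^ card ?T"
    using bij_betw_same_card[OF bij] fin by (simp add: card_PiE)
  moreover have "card ?T = (n + 1) * (n + 2) div 2" using card_sum_le_pairs(1)[of n] by linarith
  ultimately show "card ?P = CARD('a) ^ ((n + 1) * (n + 2) div 2)" by simp
  show "finite ?P"
    using bij_betw_finite[OF bij] fin by (simp add: finite_PiE)
qed

text \<open>
  Bezout's inequality for \<open>dim K[x,y]/(h,g)\<close>, in a form that needs no linear algebra: polynomials that are
  pairwise incongruent modulo the ideal \<open>(h,g)\<close> are counted instead of linearly independent classes. The sums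
  \<open>s + uh + wg\<close> with \<open>s \<in> S\<close> and \<open>u\<close>, \<open>w\<close> of bounded degree have bounded degree themselves. Such a sum determines \<open>s\<close>, and
  since \<open>h\<close> is prime to \<open>g\<close>, it determines \<open>w\<close> up to multiples of \<open>h\<close> and then \<open>u\<close>. Comparing the numbers of
  polynomials leaves the second difference of the triangular numbers, which is \<open>ab\<close>.
\<close>

lemma card_incongruent_le_bezout:
  fixes h g :: "'a::{field,finite} poly poly"
  assumes h: "prime_elem h" "total_degree h = a" and g: "\<not> h dvd g" "total_degree g \<le> b"
    and S: "finite S"
    and indep: "\<And>s t u w. s \<in> S \<Longrightarrow> t \<in> S \<Longrightarrow> s - t = u * h + w * g \<Longrightarrow> s = t"
  shows "card S \<le> CARD('a) ^ (a * b)"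
proof -
  define P where "P n = {f :: 'a poly poly. total_degree f \<le> n}" for n
  define D where "D n = (n + 1) * (n + 2) div 2" for n :: nat
  have finP: "finite (P n)" and cardP: "card (P n) = CARD('a) ^ D n" for n
    unfolding P_def D_def by (rule card_polys_total_degree_le)+
  have h0: "h \<noteq> 0" using h by (simp add: prime_elem_not_zeroI)
  obtain m where m: "\<And>s. s \<in> S \<Longrightarrow> total_degree s \<le> m"
    using S by (metis finite_nat_set_iff_bounded_le finite_imageI imageI)
  define X where "X = S \<times> P (m + b) \<times> P (m + a)"
  define \<phi> where "\<phi> = (\<lambda>(s, u, w). s + (u * h + w * g))"
  have \<phi>_in: "\<phi> x \<in> P (m + a + b)" if "x \<in> X" for x
  proof -
    obtain s u w where x: "x = (s, u, w)" by (cases x)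
    with that have deg: "total_degree s \<le> m" "total_degree u \<le> m + b" "total_degree w \<le> m + a"
      using m by (auto simp: X_def P_def)
    have "total_degree (u * h) \<le> m + a + b" "total_degree (w * g) \<le> m + a + b"
      using total_degree_mult_le[of u h] total_degree_mult_le[of w g] deg h g by linarith+
    then show ?thesis using deg by (auto simp: x \<phi>_def P_def intro!: total_degree_add_le)
  qed
  \<comment> \<open>A representative of each fibre, relative to which the last component is a multiple of \<open>h\<close>.\<close>
  define \<rho> where "\<rho> = inv_into X \<phi>"
  have \<rho>: "\<rho> (\<phi> x) \<in> X" "\<phi> (\<rho> (\<phi> x)) = \<phi> x" if "x \<in> X" for x
    using that by (auto simp: \<rho>_def intro: inv_into_into f_inv_into_f)
  have fibre: "s = s'" "w - w' \<in> (\<lambda>t. t * h) ` P m"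
    if "(s, u, w) \<in> X" "(s', u', w') \<in> X" "\<phi> (s, u, w) = \<phi> (s', u', w')" for s u w s' u' w'
  proof -
    have "s - s' = (u' - u) * h + (w' - w) * g"
      using that(3) by (simp add: \<phi>_def algebra_simps)
    with that indep show s: "s = s'" by (auto simp: X_def)
    have eq: "(w - w') * g = (u' - u) * h" using that(3) s by (simp add: \<phi>_def algebra_simps)
    then have "h dvd (w - w') * g" by simp
    then have "h dvd w - w'" using h g by (simp add: prime_elem_dvd_mult_iff)
    then obtain t where t: "w - w' = t * h" by (metis dvdE mult.commute)
    have "total_degree (w - w') \<le> m + a" using that by (auto simp: X_def P_def intro!: total_degree_diff_le)
    then have "total_degree t \<le> m"
      using t h0 h(2) by (cases "t = 0") (auto simp: total_degree_mult)
    with t show "w - w' \<in> (\<lambda>t. t * h) ` P m" by (auto simp: P_def)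
  qed
  define \<psi> where "\<psi> x = (\<phi> x, snd (snd x) - snd (snd (\<rho> (\<phi> x))))" for x
  have "inj_on \<psi> X"
  proof (rule inj_onI)
    fix x y assume x: "x \<in> X" and y: "y \<in> X" and eq: "\<psi> x = \<psi> y"
    obtain s u w where xx: "x = (s, u, w)" by (cases x)
    obtain s' u' w' where yy: "y = (s', u', w')" by (cases y)
    have \<phi>: "\<phi> (s, u, w) = \<phi> (s', u', w')" using eq by (simp add: \<psi>_def xx yy)
    then have "w = w'" using eq by (simp add: \<psi>_def xx yy)
    moreover have "s = s'" using fibre(1) x y \<phi> unfolding xx yy by blast
    ultimately show "x = y" using \<phi> h0 by (simp add: xx yy \<phi>_def)
  qed
  moreover have "\<psi> ` X \<subseteq> P (m + a + b) \<times> (\<lambda>t. t * h) ` P m"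
  proof (rule image_subsetI)
    fix y assume "y \<in> X"
    moreover obtain x1 x2 x3 where y: "y = (x1, x2, x3)" by (cases y)
    ultimately have x: "(x1, x2, x3) \<in> X" by simp
    obtain s u w where r: "\<rho> (\<phi> (x1, x2, x3)) = (s, u, w)" by (cases "\<rho> (\<phi> (x1, x2, x3))")
    have "x3 - w \<in> (\<lambda>t. t * h) ` P m" using fibre(2)[OF x, of s u w] \<rho>[OF x] r by simp
    then show "\<psi> y \<in> P (m + a + b) \<times> (\<lambda>t. t * h) ` P m"
      using \<phi>_in[OF x] r by (simp add: \<psi>_def y)
  qed
  ultimately have "card X \<le> card (P (m + a + b) \<times> (\<lambda>t. t * h) ` P m)"
    using finP by (intro card_inj_on_le) auto
  also have "\<dots> \<le> CARD('a) ^ D (m + a + b) * CARD('a) ^ D m"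
    using card_image_le[OF finP, of "\<lambda>t. t * h" m] by (simp add: card_cartesian_product cardP)
  finally have "card S * CARD('a) ^ (D (m + b) + D (m + a)) \<le> CARD('a) ^ (D (m + a + b) + D m)"
    by (simp add: X_def card_cartesian_product cardP power_add)
  also have "D (m + a + b) + D m = a * b + (D (m + b) + D (m + a))"
  proof -
    have D: "2 * D n = (n + 1) * (n + 2)" for n
      unfolding D_def by simp
    have "2 * (D (m + a + b) + D m) = 2 * (a * b + (D (m + b) + D (m + a)))"
      unfolding distrib_left D by (simp add: algebra_simps)
    then show ?thesis by simp
  qed
  finally show ?thesis by (simp add: power_add)
qed

text \<open>
  An order \<open>e \<le> N\<close> of \<open>h\<^sub>y(x,G)\<close> makes the polynomials \<open>\<alpha>(x) + \<beta>(x)(y - G)\<close> with \<open>deg \<alpha> < e\<close> and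
  \<open>deg \<beta> < min e (N - e)\<close> incongruent modulo \<open>(h,h\<^sub>y)\<close>, up to truncation of \<open>G\<close>. Indeed, suppose such a polynomial equals \<open>uh + wh\<^sub>y\<close>.
  Evaluation at \<open>G\<close> gives \<open>x\<^sup>e | \<alpha>\<close>, so \<open>\<alpha> = 0\<close>. Then \<open>w(x,G) h\<^sub>y(x,G)\<close> vanishes to order \<open>N\<close>, hence \<open>w(x,G)\<close>
  to order \<open>N - e\<close>. In the \<open>y\<close>-derivative every term now contains \<open>h\<close>, \<open>h\<^sub>y\<close> or \<open>w\<close>, which makes \<open>\<beta>\<close>
  vanish to order \<open>min e (N - e)\<close>, so \<open>\<beta> = 0\<close>. Bezout's inequality bounds the number of these polynomials.
\<close>

lemma subdegree_eval_pderiv_le: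
  fixes h :: "'a::{field,finite} poly poly" and G :: "'a fps"
  assumes h: "prime_elem h" "pderiv h \<noteq> 0"
    and N: "fps_X ^ N dvd eval_at_fps h G" "total_degree h * (total_degree h - 1) < N"
  shows "eval_at_fps (pderiv h) G \<noteq> 0"
    and "2 * subdegree (eval_at_fps (pderiv h) G) \<le> total_degree h * (total_degree h - 1)"
proof -
  define F where "F = eval_at_fps (pderiv h) G"
  define B where "B = total_degree h * (total_degree h - 1)"
  have h0: "h \<noteq> 0" using h by (simp add: prime_elem_not_zeroI)
  have pos: "total_degree h > 0"
    using h(1) h0 by (metis is_unit_iff_total_degree_eq_0 not_gr_zero prime_elem_not_unit)
  have not_dvd: "\<not> h dvd pderiv h"
  proof
    assume "h dvd pderiv h"
    then obtain t where t: "pderiv h = h * t" by blast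
    with h h0 have "total_degree (pderiv h) = total_degree h + total_degree t"
      by (metis mult_zero_right total_degree_mult)
    with total_degree_pderiv_le[of h] pos show False by simp
  qed
  \<comment> \<open>The hypothesis \<open>cancel\<close> describes the order that is left for \<open>w\<close>. With \<open>m = 0\<close> it is void, and the
    claim then bounds the order of \<open>F\<close> from the values alone; this also covers \<open>F = 0\<close>.\<close>
  have bound: "e + m \<le> B" if e: "e \<le> N" "fps_X ^ e dvd F" and "m \<le> e"
    and cancel: "\<And>W. fps_X ^ N dvd W * F \<Longrightarrow> fps_X ^ m dvd W" for e m
  proof -
    define A where "A n = {p :: 'a poly. \<forall>i\<ge>n. coeff p i = 0}" for n
    have A: "p = 0" if "p \<in> A n" "fps_X ^ n dvd fps_of_poly p" for p n
      using that by (intro poly_eqI) (metis (mono_tags, lifting) A_def coeff_0 fps_X_power_dvd_iff_nth fps_of_poly_nth mem_Collect_eq not_le)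
    have A_diff: "p - p' \<in> A n" if "p \<in> A n" "p' \<in> A n" for p p' n
      using that by (auto simp: A_def)
    define G0 where "G0 = truncate_fps N G"
    have G0: "fps_X ^ N dvd G - fps_of_poly G0"
      by (auto simp: fps_X_power_dvd_iff_nth G0_def)
    define \<sigma> where "\<sigma> = (\<lambda>(\<alpha>, \<beta>). [:\<alpha> - \<beta> * G0, \<beta>:])"
    define S where "S = \<sigma> ` (A e \<times> A m)"
    have "inj \<sigma>" by (rule injI) (auto simp: \<sigma>_def)
    then have card_S: "card S = CARD('a) ^ (e + m)"
      unfolding S_def A_def
      by (simp add: card_image inj_on_subset[OF _ subset_UNIV] card_cartesian_product card_polys_coeff_eq_0 power_add)
    have "finite S" unfolding S_def A_def by (intro finite_imageI finite_cartesian_product card_polys_coeff_eq_0)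
    moreover have "s = t" if sS: "s \<in> S" and tS: "t \<in> S" and comb: "s - t = u * h + w * pderiv h" for s t u w
    proof -
      obtain \<alpha>1 \<beta>1 where s: "s = \<sigma> (\<alpha>1, \<beta>1)" "\<alpha>1 \<in> A e" "\<beta>1 \<in> A m"
        using sS by (auto simp: S_def)
      obtain \<alpha>2 \<beta>2 where t: "t = \<sigma> (\<alpha>2, \<beta>2)" "\<alpha>2 \<in> A e" "\<beta>2 \<in> A m"
        using tS by (auto simp: S_def)
      define \<alpha> where "\<alpha> = \<alpha>1 - \<alpha>2"
      define \<beta> where "\<beta> = \<beta>1 - \<beta>2"
      have mem: "\<alpha> \<in> A e" "\<beta> \<in> A m" using s t A_diff by (auto simp: \<alpha>_def \<beta>_def)
      have diff: "s - t = [:\<alpha> - \<beta> * G0, \<beta>:]"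
        by (simp add: s t \<sigma>_def \<alpha>_def \<beta>_def algebra_simps)
      have ev: "fps_of_poly \<alpha> + fps_of_poly \<beta> * (G - fps_of_poly G0) =
          eval_at_fps u G * eval_at_fps h G + eval_at_fps w G * F"
      proof -
        have "eval_at_fps (s - t) G = fps_of_poly \<alpha> + fps_of_poly \<beta> * (G - fps_of_poly G0)"
          by (simp add: diff eval_at_fps_pCons fps_of_poly_diff fps_of_poly_mult algebra_simps)
        then show ?thesis by (simp add: comb eval_at_fps_add eval_at_fps_mult F_def)
      qed
      have "pderiv (s - t) = [:\<beta>:]" by (simp add: diff pderiv_pCons)
      then have "fps_of_poly \<beta> = eval_at_fps (pderiv (u * h + w * pderiv h)) G"
        by (simp add: comb[symmetric] eval_at_fps_pCons)
      also have "\<dots> = eval_at_fps (pderiv u) G * eval_at_fps h G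
          + (eval_at_fps u G + eval_at_fps (pderiv w) G) * F
          + eval_at_fps w G * eval_at_fps (pderiv (pderiv h)) G"
        by (simp add: pderiv_add pderiv_mult eval_at_fps_add eval_at_fps_mult F_def algebra_simps)
      finally have dev: "fps_of_poly \<beta> = \<dots>" .
      have "fps_of_poly \<alpha> = eval_at_fps u G * eval_at_fps h G + eval_at_fps w G * F
          - fps_of_poly \<beta> * (G - fps_of_poly G0)"
        using ev by (simp add: algebra_simps)
      moreover have "fps_X ^ e dvd eval_at_fps h G" "fps_X ^ e dvd G - fps_of_poly G0"
        using N(1) G0 e(1) by (auto intro: power_le_dvd)
      ultimately have "fps_X ^ e dvd fps_of_poly \<alpha>"
        using e(2) by (simp add: dvd_diff dvd_add)
      then have \<alpha>0: "\<alpha> = 0" using A mem by blast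
      then have "eval_at_fps w G * F = fps_of_poly \<beta> * (G - fps_of_poly G0) - eval_at_fps u G * eval_at_fps h G"
        using ev by (simp add: algebra_simps)
      then have "fps_X ^ N dvd eval_at_fps w G * F"
        using N(1) G0 by (simp add: dvd_diff)
      then have "fps_X ^ m dvd eval_at_fps w G" by (rule cancel)
      moreover have "fps_X ^ m dvd eval_at_fps h G" "fps_X ^ m dvd F"
        using N(1) e \<open>m \<le> e\<close> by (auto intro: power_le_dvd)
      ultimately have "fps_X ^ m dvd fps_of_poly \<beta>"
        unfolding dev by (intro dvd_add dvd_mult dvd_mult2) auto
      then have "\<beta> = 0" using A mem by blast
      with \<alpha>0 show "s = t" using diff by simp
    qed
    ultimately have "card S \<le> CARD('a) ^ B"
      unfolding B_def using h(1) not_dvd total_degree_pderiv_le by (intro card_incongruent_le_bezout) auto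
    moreover have "1 < CARD('a)"
    proof -
      have "card {0 :: 'a, 1} \<le> CARD('a)" by (intro card_mono) auto
      then show ?thesis by simp
    qed
    ultimately show ?thesis by (simp add: card_S)
  qed
  have *: "\<not> fps_X ^ Suc B dvd F" using bound[of "Suc B" 0] N(2) by (auto simp: B_def)
  then show nz: "eval_at_fps (pderiv h) G \<noteq> 0" by (auto simp: F_def)
  have e: "subdegree F \<le> B" "F \<noteq> 0" using *[unfolded fps_X_power_dvd_iff_subdegree] by auto
  \<comment> \<open>As \<open>B < N\<close>, the minimum cannot be \<open>N - subdegree F\<close>.\<close>
  have "subdegree F + min (subdegree F) (N - subdegree F) \<le> B"
  proof (rule bound)
    show "fps_X ^ min (subdegree F) (N - subdegree F) dvd W" if "fps_X ^ N dvd W * F" for W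
      using fps_X_power_dvd_mult_cancel[of N F W] that e by (auto intro: power_le_dvd simp: mult.commute)
  qed (use e N(2) in \<open>auto simp: B_def fps_X_power_dvd_iff_subdegree\<close>)
  then show "2 * subdegree (eval_at_fps (pderiv h) G) \<le> total_degree h * (total_degree h - 1)"
    using e N(2) unfolding F_def[symmetric] B_def[symmetric] by linarith
qed

section \<open>Hensel's lemma\<close>

lemma poly_add_second_order:
  fixes p :: "'a::idom poly"
  shows "\<exists>r. poly p (a + t) = poly p a + t * poly (pderiv p) a + t\<^sup>2 * r"
proof (induction p)
  case (pCons c p)
  then obtain r where r: "poly p (a + t) = poly p a + t * poly (pderiv p) a + t\<^sup>2 * r" by blast
  show ?case
    by (rule exI[of _ "poly (pderiv p) a + (a + t) * r"])
       (simp add: r pderiv_pCons algebra_simps power2_eq_square)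
qed simp

lemma poly_fps_X_power_dvd_diff:
  fixes H :: "'a::comm_ring_1 fps poly"
  assumes "fps_X ^ k dvd G - G'"
  shows "fps_X ^ k dvd poly H G - poly H G'"
proof (induction H)
  case (pCons c p)
  have "poly (pCons c p) G - poly (pCons c p) G' = (G - G') * poly p G + G' * (poly p G - poly p G')"
    by (simp add: algebra_simps)
  then show ?case using pCons.IH assms by (simp add: dvd_add)
qed simp

text \<open>
  Newton iteration, starting from an approximate root at which the derivative may vanish to order \<open>e < n/2\<close>.
  Each step changes the approximation by a multiple of \<open>x\<^bsup>n-e+k\<^esup>\<close>, so the derivative keeps its order, and the new
  value is divisible by the square of the correction, where \<open>2(n - e + k) > n + k\<close>.
\<close>

lemma hensel_fps:
  fixes H :: "'a::field fps poly"
  assumes root: "fps_X ^ n dvd poly H G" and nz: "poly (pderiv H) G \<noteq> 0"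
    and n: "2 * subdegree (poly (pderiv H) G) < n"
  shows "\<exists>\<gamma>. poly H \<gamma> = 0 \<and> fps_X ^ (n - subdegree (poly (pderiv H) G)) dvd G - \<gamma>"
proof -
  define e where "e = subdegree (poly (pderiv H) G)"
  define P where "P k F \<longleftrightarrow> fps_X ^ (n + k) dvd poly H F \<and> fps_X ^ (n - e) dvd G - F" for k F
  have en: "2 * e < n" using n by (simp add: e_def)
  have step: "\<exists>F'. P (Suc k) F' \<and> fps_X ^ (n - e + k) dvd F - F'" if F: "P k F" for k F
  proof -
    let ?D = "poly (pderiv H) F"
    have "fps_X ^ (n - e) dvd poly (pderiv H) G - ?D"
      using F by (intro poly_fps_X_power_dvd_diff) (simp add: P_def)
    then have "?D $ i = poly (pderiv H) G $ i" if "i \<le> e" for i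
      using that en by (simp add: fps_X_power_dvd_iff_nth)
    then have "?D $ e \<noteq> 0" "\<And>i. i < e \<Longrightarrow> ?D $ i = 0" using nz by (auto simp: e_def)
    then have D: "?D \<noteq> 0" "subdegree ?D = e" by (auto intro: subdegreeI)
    obtain q where q: "poly H F = fps_X ^ (n + k) * q" using F by (auto simp: P_def)
    define U where "U = fps_shift e ?D"
    have DU: "?D = fps_X ^ e * U"
      using fps_shift_cutoff'[of e ?D] D fps_cutoff_zero_iff[of e ?D] by (simp add: U_def)
    have U: "U * inverse U = 1"
      using \<open>?D $ e \<noteq> 0\<close> by (subst mult.commute) (intro inverse_mult_eq_1, simp add: U_def)
    define T where "T = - (fps_X ^ (n - e + k) * q * inverse U)"
    have "T * ?D = - (fps_X ^ (n - e + k) * fps_X ^ e * q * (U * inverse U))"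
      by (simp add: T_def DU mult_ac)
    also have "\<dots> = - poly H F" using en by (simp add: U q power_add[symmetric])
    finally have TD: "T * ?D = - poly H F" .
    obtain r where "poly H (F + T) = poly H F + T * ?D + T\<^sup>2 * r" using poly_add_second_order by blast
    then have HT: "poly H (F + T) = T\<^sup>2 * r" by (simp add: TD)
    have T: "fps_X ^ (n - e + k) dvd T" by (simp add: T_def)
    then have "fps_X ^ ((n - e + k) * 2) dvd T\<^sup>2" by (metis dvd_power_same power_mult)
    moreover have "n + Suc k \<le> (n - e + k) * 2" using en by simp
    ultimately have "fps_X ^ (n + Suc k) dvd T\<^sup>2" by (metis power_le_dvd)
    then have "fps_X ^ (n + Suc k) dvd poly H (F + T)" by (simp add: HT)
    moreover have "fps_X ^ (n - e) dvd T" using T by (rule power_le_dvd) simp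
    then have "fps_X ^ (n - e) dvd (G - F) - T" 
      using F unfolding P_def by (blast intro: dvd_diff)
    ultimately have "P (Suc k) (F + T)" by (simp add: P_def algebra_simps)
    with T show ?thesis by (intro exI[of _ "F + T"]) simp
  qed
  have "P 0 G" using root by (simp add: P_def)
  then obtain f where f: "\<And>k. P k (f k)" "\<And>k. fps_X ^ (n - e + k) dvd f k - f (Suc k)"
    using dependent_nat_choice[of P "\<lambda>k F F'. fps_X ^ (n - e + k) dvd F - F'"] step by metis
  define \<gamma> where "\<gamma> = Abs_fps (\<lambda>i. f i $ i)"
  have stable: "f (k + j) $ i = f k $ i" if "i < n - e + k" for i j k
  proof (induction j)
    case (Suc j)
    have "i < n - e + (k + j)" using that by simp
    then have "(f (k + j) - f (Suc (k + j))) $ i = 0" using f(2)[of "k + j"] unfolding fps_X_power_dvd_iff_nth by blast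
    then show ?case using Suc.IH by simp
  qed simp
  have \<gamma>: "fps_X ^ (n - e + k) dvd f k - \<gamma>" for k
    unfolding fps_X_power_dvd_iff_nth
  proof safe
    fix i assume i: "i < n - e + k"
    have "f i $ i = f k $ i"
    proof (cases "k \<le> i")
      case True
      then show ?thesis using stable[OF i, of "i - k"] by simp
    next
      case False
      then show ?thesis using stable[of i i "k - i"] en by simp
    qed
    then show "(f k - \<gamma>) $ i = 0" by (simp add: \<gamma>_def)
  qed
  have "poly H \<gamma> = 0"
  proof (rule fps_ext)
    fix i
    have "fps_X ^ (n - e + i) dvd poly H (f i) - poly H \<gamma>"
      by (rule poly_fps_X_power_dvd_diff[OF \<gamma>])
    moreover have "fps_X ^ (n - e + i) dvd poly H (f i)"
      using f(1)[of i] en unfolding P_def by (auto intro: power_le_dvd)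
    ultimately have "fps_X ^ (n - e + i) dvd poly H (f i) - (poly H (f i) - poly H \<gamma>)"
      by (rule dvd_diff[rotated])
    then show "poly H \<gamma> $ i = 0 $ i" using en by (simp add: fps_X_power_dvd_iff_nth)
  qed
  moreover have "fps_X ^ (n - e) dvd (G - f 0) + (f 0 - \<gamma>)"
    using f(1)[of 0] \<gamma>[of 0] unfolding P_def by (intro dvd_add) auto
  ultimately show ?thesis unfolding e_def by auto
qed

section \<open>The measure of the neighbourhoods of algebraic series\<close>

definition iid_uniform :: "(nat \<Rightarrow> 'a::finite) measure" where
  "iid_uniform = (\<Pi>\<^sub>M i\<in>UNIV. uniform_count_measure UNIV)"

definition cylinder :: "nat \<Rightarrow> (nat \<Rightarrow> 'a) \<Rightarrow> (nat \<Rightarrow> 'a) set" where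
  "cylinder k a = {s. \<forall>i<k. s i = a i}"

lemma space_iid_uniform [simp]: "space iid_uniform = UNIV"
  by (simp add: iid_uniform_def space_PiM space_uniform_count_measure PiE_UNIV_domain)

lemma prob_space_iid_uniform: "prob_space (iid_uniform :: (nat \<Rightarrow> 'a::finite) measure)"
  unfolding iid_uniform_def
  by (intro prob_space_PiM prob_space_uniform_count_measure) auto

text \<open>
  A cylinder fixes \<open>k\<close> independent uniform coordinates.
\<close>

lemma cylinder_measure:
  fixes a :: "nat \<Rightarrow> 'a::finite"
  shows "cylinder k a \<in> sets iid_uniform"
    and "measure iid_uniform (cylinder k a) = 1 / real CARD('a) ^ k"
proof -
  let ?M = "\<lambda>_::nat. uniform_count_measure (UNIV :: 'a set)"
  have "product_prob_space ?M"
    by (rule product_prob_spaceI, rule prob_space_uniform_count_measure) simp_all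
  then interpret product_prob_space ?M UNIV .
  have eq: "cylinder k a = prod_emb UNIV ?M {..<k} (PiE {..<k} (\<lambda>i. {a i}))"
    by (rule Set.set_eqI) (simp add: cylinder_def prod_emb_def space_uniform_count_measure PiE_iff Ball_def)
  show "cylinder k a \<in> sets iid_uniform"
    unfolding eq iid_uniform_def
    by (rule sets_PiM_I) (simp_all add: sets_uniform_count_measure)
  have "measure (PiM UNIV ?M) (cylinder k a) = (\<Prod>i<k. measure (?M i) {a i})"
    unfolding eq by (rule measure_PiM_emb) (simp_all add: sets_uniform_count_measure)
  also have "\<dots> = 1 / real CARD('a) ^ k"
    by (simp add: measure_uniform_count_measure power_one_over)
  finally show "measure iid_uniform (cylinder k a) = 1 / real CARD('a) ^ k"
    by (simp only: iid_uniform_def)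
qed

text \<open>
  The sequences that agree with a power series root of \<open>h\<close> as far as Hensel's lemma guarantees for approximate
  roots of order \<open>L deg h\<close>.
\<close>

definition near_roots :: "nat \<Rightarrow> 'a::field poly poly \<Rightarrow> (nat \<Rightarrow> 'a) set" where
  "near_roots L h = (\<Union>\<gamma>\<in>{\<gamma>. eval_at_fps h \<gamma> = 0}.
     cylinder (L * total_degree h - total_degree h * (total_degree h - 1) div 2) (fps_nth \<gamma>))"

definition near_roots_of_degree_upto :: "nat \<Rightarrow> nat \<Rightarrow> (nat \<Rightarrow> 'a::field) set" where
  "near_roots_of_degree_upto L d = (\<Union>D\<in>{1..d}. \<Union>h\<in>{h. total_degree h = D}. near_roots L h)"

text \<open>
  After passing to an irreducible separable polynomial of degree \<open>D\<close>, the derivative has order at most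
  \<open>D(D-1)/2\<close>, which is less than \<open>LD/2\<close> as \<open>D \<le> L\<close>; so Hensel's lemma applies.
\<close>

lemma vanishes_at_slope_imp_near_roots_of_degree_upto:
  fixes h :: "'a::{field,finite} poly poly"
  assumes "2 \<le> L" "d \<le> L" "total_degree h \<le> d" "vanishes_at_slope L h (Abs_fps s)"
  shows "s \<in> near_roots_of_degree_upto L d"
proof -
  define G where "G = Abs_fps s"
  obtain f where f: "total_degree f \<le> total_degree h" "vanishes_at_slope L f G"
      "irreducible f" "pderiv f \<noteq> 0"
    using vanishes_at_slope_imp_irreducible_separable[OF assms(1,4)] unfolding G_def by blast
  define D where "D = total_degree f"
  have D: "1 \<le> D" "D \<le> d" "fps_X ^ (L * D) dvd eval_at_fps f G"
    using f assms(3) by (auto simp: vanishes_at_slope_def D_def)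
  have "D * (D - 1) < D * L" using D assms(2) by (intro mult_strict_left_mono) auto
  then have lt: "D * (D - 1) < L * D" by (simp add: mult.commute)
  have prime: "prime_elem f" using f(3) by simp
  define F where "F = eval_at_fps (pderiv f) G"
  have F: "F \<noteq> 0" "2 * subdegree F \<le> D * (D - 1)"
    using subdegree_eval_pderiv_le[OF prime f(4), of "L * D" G] D lt by (auto simp: D_def F_def)
  have F_eq: "poly (pderiv (map_poly fps_of_poly f)) G = F"
    by (simp add: F_def eval_at_fps_def pderiv_map_fps_of_poly)
  have "\<exists>\<gamma>. poly (map_poly fps_of_poly f) \<gamma> = 0 \<and> fps_X ^ (L * D - subdegree F) dvd G - \<gamma>"
    using hensel_fps[of "L * D" "map_poly fps_of_poly f" G] D F lt
    unfolding F_eq by (simp add: eval_at_fps_def)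
  then obtain \<gamma> where \<gamma>: "eval_at_fps f \<gamma> = 0" "fps_X ^ (L * D - subdegree F) dvd G - \<gamma>"
    unfolding eval_at_fps_def by blast
  have "L * D - D * (D - 1) div 2 \<le> L * D - subdegree F" using F(2) by (intro diff_le_mono2) simp
  with \<gamma>(2) have "fps_X ^ (L * D - D * (D - 1) div 2) dvd G - \<gamma>" by (rule power_le_dvd)
  then have "s \<in> cylinder (L * D - D * (D - 1) div 2) (fps_nth \<gamma>)"
    by (simp add: fps_X_power_dvd_iff_nth cylinder_def G_def)
  then have "s \<in> near_roots L f" using \<gamma>(1) by (auto simp: near_roots_def D_def)
  then show ?thesis using D unfolding near_roots_of_degree_upto_def D_def by auto
qed

lemma roots_in_fps:
  fixes h :: "'a::field poly poly"
  assumes "h \<noteq> 0"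
  shows "finite {\<gamma>. eval_at_fps h \<gamma> = 0}" "card {\<gamma>. eval_at_fps h \<gamma> = 0} \<le> total_degree h"
proof -
  let ?H = "map_poly fps_of_poly h"
  have inj: "fps_of_poly a = 0 \<longleftrightarrow> a = 0" for a :: "'a poly"
    by (metis fps_of_poly_0 fps_of_poly_eq_iff)
  have nz: "?H \<noteq> 0" using assms by (simp add: map_poly_eq_0_iff inj)
  have "card {\<gamma>. poly ?H \<gamma> = 0} \<le> degree ?H"
    using nz by (intro card_poly_roots_bound) 
  also have "\<dots> = degree h" by (intro degree_map_poly) (simp add: inj)
  also have "\<dots> \<le> total_degree h"
  proof -
    have "coeff (coeff h (degree h)) (degree (coeff h (degree h))) \<noteq> 0" using assms by simp
    then have "degree (coeff h (degree h)) + degree h \<le> total_degree h"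
      using total_degree_le_iff[of h "total_degree h"] by blast
    then show ?thesis by simp
  qed
  finally show "card {\<gamma>. eval_at_fps h \<gamma> = 0} \<le> total_degree h"
    by (simp add: eval_at_fps_def)
  show "finite {\<gamma>. eval_at_fps h \<gamma> = 0}"
    using poly_roots_finite[OF nz] by (simp add: eval_at_fps_def)
qed

lemma near_roots_measure:
  fixes h :: "'a::{field,finite} poly poly"
  assumes "total_degree h = D" "1 \<le> D"
  shows "near_roots L h \<in> sets iid_uniform"
    and "measure iid_uniform (near_roots L h) \<le> D / real CARD('a) ^ (L * D - D * (D - 1) div 2)"
proof -
  interpret prob_space "iid_uniform :: (nat \<Rightarrow> 'a) measure" by (rule prob_space_iid_uniform)
  let ?R = "{\<gamma>. eval_at_fps h \<gamma> = 0}" and ?k = "L * D - D * (D - 1) div 2"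
  have "h \<noteq> 0" using assms by auto
  note R = roots_in_fps[OF this]
  show "near_roots L h \<in> sets iid_uniform"
    unfolding near_roots_def using R(1) by (intro sets.finite_UN cylinder_measure)
  have "prob (near_roots L h) \<le> (\<Sum>\<gamma>\<in>?R. prob (cylinder ?k (fps_nth \<gamma>)))"
    unfolding near_roots_def assms(1)
    using R(1) by (intro finite_measure_subadditive_finite) (auto intro: cylinder_measure)
  also have "\<dots> = card ?R * (1 / real CARD('a) ^ ?k)" by (simp add: cylinder_measure)
  also have "\<dots> \<le> D * (1 / real CARD('a) ^ ?k)"
    using R(2) assms(1) by (intro mult_right_mono) auto
  finally show "prob (near_roots L h) \<le> D / real CARD('a) ^ ?k" by simp
qed

text \<open>
  The union bound. In degree \<open>D\<close> there are at most \<open>q\<^bsup>(D+1)(D+2)/2\<^esup>\<close> polynomials, each with at most \<open>D\<close> roots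
  and around each root a cylinder of measure \<open>q\<^bsup>D(D-1)/2-LD\<^esup>\<close>. The resulting exponent \<open>1 - D(L - D - 1)\<close> is at most
  \<open>1 - (L - d - 1)\<close> for \<open>1 \<le> D \<le> d < L\<close>.
\<close>

lemma near_roots_of_degree_upto_measure:
  assumes "d < L"
  shows "near_roots_of_degree_upto L d \<in> sets (iid_uniform :: (nat \<Rightarrow> 'a::{field,finite}) measure)"
    and "measure (iid_uniform :: (nat \<Rightarrow> 'a) measure) (near_roots_of_degree_upto L d)
      \<le> (real d)\<^sup>2 * real CARD('a) / real CARD('a) ^ (L - d - 1)"
proof -
  interpret prob_space "iid_uniform :: (nat \<Rightarrow> 'a) measure" by (rule prob_space_iid_uniform)
  define q where "q = real CARD('a)"
  have "0 < CARD('a)" by (rule finite_UNIV_card_ge_0) simp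
  then have q: "1 \<le> q" unfolding q_def by linarith
  let ?P = "\<lambda>D. {h :: 'a poly poly. total_degree h = D}"
  have fin: "finite (?P D)" for D
    by (rule finite_subset[OF _ card_polys_total_degree_le(2)[of D]]) auto
  have cardP: "card (?P D) \<le> CARD('a) ^ ((D + 1) * (D + 2) div 2)" for D
    unfolding card_polys_total_degree_le(1)[of D, symmetric]
    by (intro card_mono card_polys_total_degree_le) auto
  have sets: "(\<Union>h\<in>?P D. near_roots L h) \<in> sets iid_uniform" if "D \<in> {1..d}" for D
    using fin that by (intro sets.finite_UN near_roots_measure) auto
  then show "near_roots_of_degree_upto L d \<in> sets (iid_uniform :: (nat \<Rightarrow> 'a) measure)"
    unfolding near_roots_of_degree_upto_def by (intro sets.finite_UN[OF finite_atLeastAtMost])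
  have "prob (near_roots_of_degree_upto L d) \<le> (\<Sum>D=1..d. prob (\<Union>h\<in>?P D. near_roots L h))"
    unfolding near_roots_of_degree_upto_def
    using sets by (intro finite_measure_subadditive_finite) auto
  also have "\<dots> \<le> (\<Sum>D=1..d. d * q / q ^ (L - d - 1))"
  proof (rule sum_mono)
    fix D assume D: "D \<in> {1..d}"
    define k where "k = L * D - D * (D - 1) div 2"
    define r where "r = (D + 1) * (D + 2) div 2"
    have "prob (\<Union>h\<in>?P D. near_roots L h) \<le> (\<Sum>h\<in>?P D. prob (near_roots L h))"
      using fin D by (intro finite_measure_subadditive_finite) (auto intro: near_roots_measure)
    also have "\<dots> \<le> (\<Sum>h\<in>?P D. D / q ^ k)"
      unfolding q_def k_def using D by (intro sum_mono near_roots_measure) auto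
    also have "\<dots> = card (?P D) * (D / q ^ k)" by simp
    also have "\<dots> \<le> q ^ r * (D / q ^ k)"
    proof (rule mult_right_mono)
      have "real (card (?P D)) \<le> real (CARD('a) ^ r)"
        unfolding r_def of_nat_le_iff by (rule cardP)
      then show "real (card (?P D)) \<le> q ^ r" by (simp add: q_def)
    qed (use q in auto)
    also have "\<dots> \<le> D * (q / q ^ (L - d - 1))"
    proof -
      have "r + (L - d - 1) \<le> k + 1"
      proof -
        obtain E where E: "D = Suc E" using D by (cases D) auto
        obtain x where x: "d = D + x" using D le_Suc_ex by auto
        obtain y where y: "L = d + 1 + y" using assms by (metis Suc_eq_plus1 Suc_leI le_Suc_ex)
        have r: "2 * r = (D + 1) * (D + 2)" unfolding r_def by simp
        obtain e where e: "D * (D - 1) = 2 * e"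
          by (metis E diff_Suc_1 even_Suc even_mult_iff evenE)
        have "D * (D - 1) \<le> 2 * (L * D)" unfolding x y by (simp add: E algebra_simps)
        then have "2 * k = 2 * (L * D) - D * (D - 1)"
          unfolding k_def e by simp
        moreover have "2 * r + 2 * (L - d - 1) + D * (D - 1) \<le> 2 * (L * D) + 2"
          unfolding r x y by (simp add: E algebra_simps)
        ultimately show ?thesis by linarith
      qed
      then have "q ^ (r + (L - d - 1)) \<le> q ^ (k + 1)" using q by (intro power_increasing)
      then have "q ^ r / q ^ k \<le> q / q ^ (L - d - 1)"
        using q by (simp add: field_simps power_add)
      then have "D * (q ^ r / q ^ k) \<le> D * (q / q ^ (L - d - 1))" by (intro mult_left_mono) auto
      then show ?thesis by (simp add: mult_ac)
    qed
    also have "\<dots> \<le> d * (q / q ^ (L - d - 1))"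
      using D q by (intro mult_right_mono) auto
    finally show "prob (\<Union>h\<in>?P D. near_roots L h) \<le> d * q / q ^ (L - d - 1)" by simp
  qed
  also have "\<dots> = (real d)\<^sup>2 * q / q ^ (L - d - 1)" by (simp add: power2_eq_square)
  finally show "prob (near_roots_of_degree_upto L d) \<le> (real d)\<^sup>2 * real CARD('a) / real CARD('a) ^ (L - d - 1)"
    by (simp add: q_def)
qed

section \<open>Expansion complexity of almost every sequence\<close>

text \<open>
  The choice \<open>L d \<le> N\<close> turns divisibility by \<open>x\<^sup>N\<close> into order at least \<open>L\<close> per degree. If the first \<open>N\<close> terms
  vanish, the complexity is \<open>0\<close> by convention, and \<open>h = y\<close> of degree \<open>1\<close> serves as the witness.
\<close>

lemma expansion_complexity_le_imp_near_roots_of_degree_upto: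
  fixes s :: "nat \<Rightarrow> 'a::{field,finite}"
  assumes "expansion_complexity s N \<le> d" "1 \<le> d" "2 \<le> L" "d \<le> L" "L * d \<le> N" 
  shows "s \<in> near_roots_of_degree_upto L d"
proof -
  define G where "G = Abs_fps s"
  have "\<exists>h. h \<noteq> 0 \<and> fps_X ^ N dvd eval_at_fps h G \<and> total_degree h \<le> d"
  proof (cases "\<forall>i<N. s i = 0")
    case True
    have "total_degree [:0, 1 :: 'a poly:] \<le> 1"
      unfolding total_degree_le_iff by (auto simp: coeff_pCons split: nat.splits if_splits)
    moreover have "eval_at_fps [:0, 1:] G = G"
      by (simp only: eval_at_fps_pCons) simp
    moreover have "fps_X ^ N dvd G" using True by (simp add: fps_X_power_dvd_iff_nth G_def)
    ultimately show ?thesis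
      using assms(2) by (intro exI[of _ "[:0, 1:]"]) simp
  next
    case False
    let ?Q = "\<lambda>e. \<exists>h. h \<noteq> 0 \<and> fps_X ^ N dvd eval_at_fps h G \<and> total_degree h = e"
    have "\<exists>e. ?Q e" using expansion_complexity_witness[of N G] by blast
    then have "?Q (LEAST e. ?Q e)" by (rule LeastI_ex)
    then have "?Q (expansion_complexity s N)"
      unfolding expansion_complexity_def if_not_P[OF False] G_def .
    with assms(1) show ?thesis by auto
  qed
  then obtain h where h: "h \<noteq> 0" "fps_X ^ N dvd eval_at_fps h G" "total_degree h \<le> d" by blast
  have "0 < total_degree h"
  proof (rule ccontr)
    assume "\<not> ?thesis"
    then obtain c where c: "h = [:[:c:]:]" using total_degree_eq_0_imp_const by blast
    have "0 < L * d" using assms by simp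
    then have "0 < N" using assms(5) by linarith
    with h(2) have "eval_at_fps h G $ 0 = 0" by (simp add: fps_X_power_dvd_iff_nth)
    with h(1) show False by (simp add: c eval_at_fps_pCons)
  qed
  moreover have "L * total_degree h \<le> N" using h(3) assms(5) by (meson le_trans mult_le_mono2)
  ultimately have "vanishes_at_slope L h G"
    using h(2) by (auto simp: vanishes_at_slope_def intro: power_le_dvd)
  then show ?thesis
    using assms h(3) by (intro vanishes_at_slope_imp_near_roots_of_degree_upto) (auto simp: G_def)
qed

text \<open>
  Borel--Cantelli with \<open>d = \<lfloor>c \<surd>N\<rfloor>\<close> and \<open>L = \<lfloor>\<surd>N / c\<rfloor>\<close>. Since \<open>c < 1\<close>, the difference \<open>L - d\<close> exceeds
  \<open>(1/c - c) \<surd>N - 1\<close>, so the measures decay faster than any power of \<open>N\<close>.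
\<close>

lemma AE_eventually_expansion_complexity_ge:
  fixes c :: real
  assumes c: "0 < c" "c < 1"
  shows "AE s in (iid_uniform :: (nat \<Rightarrow> 'a::{field,finite}) measure).
     \<forall>\<^sub>F N in sequentially. c * sqrt (real N) \<le> real (expansion_complexity s N)"
proof -
  interpret prob_space "iid_uniform :: (nat \<Rightarrow> 'a) measure" by (rule prob_space_iid_uniform)
  define q where "q = real CARD('a)"
  have "card {0 :: 'a, 1} \<le> CARD('a)" by (intro card_mono) auto
  then have q: "2 \<le> q" by (simp add: q_def)
  define d where "d N = nat \<lfloor>c * sqrt (real N)\<rfloor>" for N
  define L where "L N = nat \<lfloor>sqrt (real N) / c\<rfloor>" for N
  define a where "a = 1 / c - c"
  have "c * c < 1 * 1" using c by (intro mult_strict_mono) auto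
  then have a: "a > 0" using c by (simp add: a_def field_simps)
  have d_le: "real (d N) \<le> c * sqrt (real N)" for N
    using c by (simp add: d_def)
  have L_le: "real (L N) \<le> sqrt (real N) / c" and L_gt: "sqrt (real N) / c - 1 < real (L N)" for N
    using c by (auto simp: L_def)
  have Ld: "L N * d N \<le> N" for N
  proof -
    have "real (L N) * real (d N) \<le> (sqrt (real N) / c) * (c * sqrt (real N))"
      using c by (intro mult_mono d_le L_le) auto
    also have "\<dots> = real N" using c by simp
    finally have "real (L N * d N) \<le> real N" by simp
    then show ?thesis by (simp only: of_nat_le_iff)
  qed
  have large: "\<forall>\<^sub>F N in sequentially. 1 \<le> c * sqrt (real N) \<and> 2 \<le> a * sqrt (real N) \<and> 3 \<le> sqrt (real N) / c"
    using c a by (intro eventually_conj; real_asymp)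
  have ok: "1 \<le> d N" "2 \<le> L N" "d N < L N" 
    if "1 \<le> c * sqrt (real N) \<and> 2 \<le> a * sqrt (real N) \<and> 3 \<le> sqrt (real N) / c" for N
  proof -
    show "1 \<le> d N" using that by (simp add: d_def le_nat_iff)
    show "2 \<le> L N" using that L_gt[of N] by linarith
    have "a * sqrt (real N) = sqrt (real N) / c - c * sqrt (real N)" by (simp add: a_def algebra_simps)
    then show "d N < L N" using that L_gt[of N] d_le[of N] by linarith
  qed
  define A :: "nat \<Rightarrow> (nat \<Rightarrow> 'a) set"
    where "A N = (if d N < L N then near_roots_of_degree_upto (L N) (d N) else {})" for N
  have "AE s in (iid_uniform :: (nat \<Rightarrow> 'a) measure). \<forall>\<^sub>F N in sequentially. s \<in> space iid_uniform - A N"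
  proof (rule borel_cantelli_AE1)
    show "A N \<in> sets iid_uniform" for N by (simp add: A_def near_roots_of_degree_upto_measure)
    show "emeasure iid_uniform (A N) < \<infinity>" for N by (simp add: less_top[symmetric])
    have bound: "prob (A N) \<le> q ^ 3 * (real N * exp (- (a * ln q) * sqrt (real N)))" for N
    proof (cases "d N < L N")
      case True
      have "a * sqrt (real N) - 2 \<le> real (L N - d N - 1)"
        using L_gt[of N] d_le[of N] True by (simp add: a_def algebra_simps of_nat_diff)
      then have "q powr (a * sqrt (real N) - 2) \<le> q powr real (L N - d N - 1)"
        using q by (intro powr_mono) auto
      also have "\<dots> = q ^ (L N - d N - 1)" using q by (intro powr_realpow) auto
      finally have pow: "q powr (a * sqrt (real N) - 2) \<le> q ^ (L N - d N - 1)" .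
      have pow_eq: "q powr (a * sqrt (real N) - 2) = exp (a * ln q * sqrt (real N)) / q\<^sup>2"
        using q by (simp add: powr_diff) (simp add: powr_def mult_ac)
      have "real (d N) \<le> 1 * sqrt (real N)"
        using d_le[of N] c by (meson less_imp_le mult_right_mono order_trans real_sqrt_ge_zero of_nat_0_le_iff)
      then have "(real (d N))\<^sup>2 \<le> (sqrt (real N))\<^sup>2" by (intro power_mono) auto
      then have d2: "(real (d N))\<^sup>2 \<le> real N" by simp
      have "prob (A N) \<le> (real (d N))\<^sup>2 * q / q ^ (L N - d N - 1)"
        using near_roots_of_degree_upto_measure(2)[OF True, where ?'a = 'a] True by (simp add: A_def q_def)
      also have "\<dots> \<le> real N * q / q powr (a * sqrt (real N) - 2)"
        using pow d2 q by (intro frac_le mult_right_mono mult_nonneg_nonneg) auto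
      also have "\<dots> = q ^ 3 * (real N * exp (- (a * ln q) * sqrt (real N)))"
        unfolding pow_eq using q by (simp add: exp_minus field_simps power3_eq_cube power2_eq_square)
      finally show ?thesis .
    qed (use q in \<open>simp add: A_def\<close>)
    have b: "a * ln q > 0" using a q by simp
    have "(\<lambda>N. real N * exp (- (a * ln q) * sqrt (real N))) \<in> O(\<lambda>N. 1 / real N ^ 2)"
    proof -
      have "(\<lambda>N. real N * exp (- b * sqrt (real N))) \<in> O(\<lambda>N. 1 / real N ^ 2)" if "b > 0" for b :: real
        using that by real_asymp
      from this[OF b] show ?thesis .
    qed
    then have "summable (\<lambda>N. real N * exp (- (a * ln q) * sqrt (real N)))"
      by (rule summable_comparison_test_bigo[rotated])
         (use inverse_power_summable[of 2, where ?'a = real] in \<open>simp add: field_simps\<close>)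
    then have "summable (\<lambda>N. q ^ 3 * (real N * exp (- (a * ln q) * sqrt (real N))))"
      by (rule summable_mult)
    then show "summable (\<lambda>N. prob (A N))"
      by (rule summable_comparison_test'[of _ 0]) (use bound in auto)
  qed
  then show ?thesis
  proof eventually_elim
    case (elim s)
    from elim large show ?case
    proof eventually_elim
      case (elim N)
      note ok = ok[OF elim(2)]
      have notin: "s \<notin> near_roots_of_degree_upto (L N) (d N)" using elim(1) ok by (simp add: A_def)
      have "\<not> expansion_complexity s N \<le> d N"
        using expansion_complexity_le_imp_near_roots_of_degree_upto[of s N "d N" "L N"] notin ok Ld[of N] by auto
      then have "d N + 1 \<le> expansion_complexity s N" by simp
      then have "real (d N) + 1 \<le> real (expansion_complexity s N)" by linarith
      moreover have "c * sqrt (real N) \<le> real (d N) + 1"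
        unfolding d_def using c by linarith
      ultimately show ?case by linarith
    qed
  qed
qed

theorem theorem4:
  "AE s in (sequence_measure :: (nat \<Rightarrow> 'a::{field,finite}) measure).
     liminf (\<lambda>N. ereal (real (expansion_complexity s N) / real N powr (1 / 2))) \<ge> 1"
proof -
  define c where "c k = 1 - 1 / (real k + 2)" for k :: nat
  have c: "0 < c k" "c k < 1" for k by (auto simp: c_def field_simps)
  have lim: "(\<lambda>k. ereal (c k)) \<longlonglongrightarrow> ereal 1"
    unfolding c_def by (intro tendsto_ereal) real_asymp
  have "AE s in (iid_uniform :: (nat \<Rightarrow> 'a) measure). \<forall>k.
      \<forall>\<^sub>F N in sequentially. c k * sqrt (real N) \<le> real (expansion_complexity s N)"
    unfolding AE_all_countable using AE_eventually_expansion_complexity_ge[OF c] by blast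
  then have "AE s in (iid_uniform :: (nat \<Rightarrow> 'a) measure).
     liminf (\<lambda>N. ereal (real (expansion_complexity s N) / real N powr (1 / 2))) \<ge> 1"
  proof eventually_elim
    case (elim s)
    have "ereal (c k) \<le> liminf (\<lambda>N. ereal (real (expansion_complexity s N) / real N powr (1 / 2)))" for k
    proof (rule Liminf_bounded)
      show "\<forall>\<^sub>F N in sequentially. ereal (c k) \<le> ereal (real (expansion_complexity s N) / real N powr (1 / 2))"
        using spec[OF elim, of k] eventually_gt_at_top[of 0]
        by eventually_elim (simp add: powr_half_sqrt field_simps)
    qed
    then have "ereal 1 \<le> liminf (\<lambda>N. ereal (real (expansion_complexity s N) / real N powr (1 / 2)))"
      by (intro LIMSEQ_le_const2[OF lim]) auto
    then show ?case by (simp add: one_ereal_def)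
  qed
  then show ?thesis
    unfolding sequence_measure_def iid_uniform_def by (rule AE_completion)
qed

end
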